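(* Let $\mathcal{S}(\lambda)$ be an $(n+r)\times (n+r)$ system polynomial (regular or singular) of degree $m$. Then every Fiedler pencil $\mathbb{L}_{\sigma}(\lambda)$ of $\mathcal{S}(\lambda)$ is a Rosenbrock linearization of $\mathcal{S}(\lambda)$, i.e., there exist $nm\times nm$ unimodular matrix polynomials $U(\lambda), V(\lambda)$ such that $$\left[\begin{array}{c|c} U(\lambda) & 0\\ \hline 0 & I_r\end{array}\right]\mathbb{L}_\sigma(\lambda)\left[\begin{array}{c|c} V(\lambda) & 0\\ \hline 0 & I_r\end{array}\right] = \left[\begin{array}{c|c} I_{(m-1)n} & 0\\ \hline 0 & \mathcal{S}(\lambda)\end{array}\right].$$
   Context: A system polynomial of degree $m$ is $\mathcal{S}(\lambda) = \left[\begin{array}{c|c} P(\lambda) & C\\ \hline B & A-\lambda E\end{array}\right]$ with $P(\lambda)=\sum_{j=0}^m\lambda^j A_j$ an $n\times n$ matrix polynomial of degree $m$ ($A_m\ne0$), $C\in\mathbb{C}^{n\times r}$, $B\in\mathbb{C}^{r\times n}$ constant, and $A-\lambda E$ an $r\times r$ pencil. Its Fiedler matrices are $\mathbb{M}_0 = \left[\begin{array}{c|c} M_0 & -e_m\otimes C\\ \hline -e_m^T\otimes B & -A\end{array}\right]$, $\mathbb{M}_m=\mathrm{diag}(M_m,-E)$, $\mathbb{M}_i=\mathrm{diag}(M_i,I_r)$ ($1\le i\le m-1$), where $e_m$ is the $m$-th column of $I_m$, $M_0=\mathrm{diag}(I_{(m-1)n},-A_0)$, $M_m=\mathrm{diag}(A_m,I_{(m-1)n})$,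 $M_i=\mathrm{diag}\left(I_{(m-i-1)n},\left[\begin{smallmatrix}-A_i & I_n\\ I_n&0\end{smallmatrix}\right],I_{(i-1)n}\right)$. For a bijection $\sigma:\{0,\ldots,m-1\}\to\{1,\ldots,m\}$ the Fiedler pencil is $\mathbb{L}_\sigma(\lambda)=\lambda\mathbb{M}_m-\mathbb{M}_{\sigma^{-1}(1)}\cdots\mathbb{M}_{\sigma^{-1}(m)}$. A matrix polynomial is unimodular if its determinant is a nonzero constant. An $(nm+r)\times(nm+r)$ system pencil $\mathbb{L}(\lambda)$ is a Rosenbrock linearization of an $(n+r)\times(n+r)$ system polynomial $\mathcal{X}(\lambda)$ of degree $m>1$ if there are $nm\times nm$ unimodular $U(\lambda),V(\lambda)$ with $\mathrm{diag}(U(\lambda),I_r)\,\mathbb{L}(\lambda)\,\mathrm{diag}(V(\lambda),I_r)=\mathrm{diag}(I_{(m-1)n},\mathcal{X}(\lambda))$. *)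

theory Defs
  imports "Jordan_Normal_Form.Determinant" "HOL-Computational_Algebra.Polynomial"
begin

definition block_diag :: "'a::zero mat \<Rightarrow> 'a mat \<Rightarrow> 'a mat" where
  "block_diag X Y = four_block_mat X (0\<^sub>m (dim_row X) (dim_col Y)) (0\<^sub>m (dim_row Y) (dim_col X)) Y"

definition const_pm :: "complex mat \<Rightarrow> complex poly mat" where
  "const_pm M = map_mat (\<lambda>a. [:a:]) M"

definition lam_pm :: "complex mat \<Rightarrow> complex poly mat" where
  "lam_pm M = map_mat (\<lambda>a. monom a 1) M"

definition unimodular :: "complex poly mat \<Rightarrow> bool" where
  "unimodular U \<longleftrightarrow> dim_row U = dim_col U \<and> (\<exists>c. c \<noteq> 0 \<and> det U = [:c:])"

definition mat_poly :: "nat \<Rightarrow> nat \<Rightarrow> (nat \<Rightarrow> complex mat) \<Rightarrow> complex poly mat" where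
  "mat_poly n m A = mat n n (\<lambda>(i,k). \<Sum>j\<le>m. monom (A j $$ (i,k)) j)"

definition system_poly :: "nat \<Rightarrow> nat \<Rightarrow> (nat \<Rightarrow> complex mat) \<Rightarrow> complex mat \<Rightarrow> complex mat
    \<Rightarrow> complex mat \<Rightarrow> complex mat \<Rightarrow> complex poly mat" where
  "system_poly n m A C B Ap E =
     four_block_mat (mat_poly n m A) (const_pm C) (const_pm B) (const_pm Ap - lam_pm E)"

text \<open>e_m \<otimes> C (an (m n) x r matrix with C in the last block row) and e_m^T \<otimes> B.\<close>
definition em_kron_col :: "nat \<Rightarrow> nat \<Rightarrow> complex mat \<Rightarrow> complex mat" where
  "em_kron_col n m C = mat (n*m) (dim_col C)
     (\<lambda>(i,j). if (m - 1) * n \<le> i then C $$ (i - (m - 1) * n, j) else 0)"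

definition em_kron_row :: "nat \<Rightarrow> nat \<Rightarrow> complex mat \<Rightarrow> complex mat" where
  "em_kron_row n m B = mat (dim_row B) (n*m)
     (\<lambda>(i,j). if (m - 1) * n \<le> j then B $$ (i, j - (m - 1) * n) else 0)"

definition fiedler_M :: "nat \<Rightarrow> nat \<Rightarrow> (nat \<Rightarrow> complex mat) \<Rightarrow> nat \<Rightarrow> complex mat" where
  "fiedler_M n m A i =
    (if i = 0 then block_diag (1\<^sub>m ((m - 1) * n)) (- A 0)
     else if i = m then block_diag (A m) (1\<^sub>m ((m - 1) * n))
     else block_diag (1\<^sub>m ((m - i - 1) * n))
            (block_diag (four_block_mat (- A i) (1\<^sub>m n) (1\<^sub>m n) (0\<^sub>m n n)) (1\<^sub>m ((i - 1) * n))))"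

definition sys_fiedler_M :: "nat \<Rightarrow> nat \<Rightarrow> nat \<Rightarrow> (nat \<Rightarrow> complex mat) \<Rightarrow> complex mat \<Rightarrow> complex mat
    \<Rightarrow> complex mat \<Rightarrow> complex mat \<Rightarrow> nat \<Rightarrow> complex mat" where
  "sys_fiedler_M n m r A C B Ap E i =
    (if i = 0 then four_block_mat (fiedler_M n m A 0) (- em_kron_col n m C)
                     (- em_kron_row n m B) (- Ap)
     else if i = m then block_diag (fiedler_M n m A m) (- E)
     else block_diag (fiedler_M n m A i) (1\<^sub>m r))"

definition fiedler_pencil :: "nat \<Rightarrow> nat \<Rightarrow> nat \<Rightarrow> (nat \<Rightarrow> complex mat) \<Rightarrow> complex mat \<Rightarrow> complex mat
    \<Rightarrow> complex mat \<Rightarrow> complex mat \<Rightarrow> (nat \<Rightarrow> nat) \<Rightarrow> complex poly mat" where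
  "fiedler_pencil n m r A C B Ap E \<sigma> =
     lam_pm (sys_fiedler_M n m r A C B Ap E m)
     - const_pm (foldr (\<lambda>k acc. sys_fiedler_M n m r A C B Ap E (the_inv_into {0..<m} \<sigma> k) * acc)
                   [1..<m+1] (1\<^sub>m (n*m + r)))"

definition rosenbrock_linearization :: "nat \<Rightarrow> nat \<Rightarrow> nat \<Rightarrow> complex poly mat \<Rightarrow> complex poly mat \<Rightarrow> bool" where
  "rosenbrock_linearization n m r L X \<longleftrightarrow>
     (\<exists>U V. U \<in> carrier_mat (n*m) (n*m) \<and> V \<in> carrier_mat (n*m) (n*m) \<and>
        unimodular U \<and> unimodular V \<and>
        block_diag U (1\<^sub>m r) * L * block_diag V (1\<^sub>m r) = block_diag (1\<^sub>m ((m - 1) * n)) X)"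

end

theory Submission
  imports Defs
begin

text \<open>
  The Fiedler factor of highest index \<open>m - 1\<close> commutes with all factors of index below \<open>m - 2\<close>, so the
  product of the factors equals \<open>M\<^sub>m\<^sub>-\<^sub>1 \<cdot> diag(I, Q)\<close> or \<open>diag(I, Q) \<cdot> M\<^sub>m\<^sub>-\<^sub>1\<close>, where \<open>Q\<close> is a product
  of Fiedler factors for the coefficients \<open>A\<^sub>0, \<dots>, A\<^sub>m\<^sub>-\<^sub>2\<close>. Writing \<open>G = \<lambda>P + A\<^sub>m\<^sub>-\<^sub>1\<close>, where \<open>P\<close> is
  the leading block (initially \<open>A\<^sub>m\<close>), elementary operations with the blocks \<open>[0, -I; I, G]\<close> and
  \<open>[I, \<lambda>I; 0, I]\<close> split off an identity block and leave the pencil \<open>\<lambda> diag(G, I, -E) - Q\<close>. So one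
  coefficient is eliminated and the leading block makes one step of Horner's scheme. After \<open>m - 1\<close>
  steps the system polynomial remains. The operations never touch the last \<open>r\<close> rows and columns and
  have determinant 1.
\<close>

section \<open>Calculus of block diagonal matrices\<close>

lemma block_diag_carrier [intro]:
  "X \<in> carrier_mat a b \<Longrightarrow> Y \<in> carrier_mat c d \<Longrightarrow> block_diag X Y \<in> carrier_mat (a + c) (b + d)"
  by (auto simp: block_diag_def)

lemma dim_block_diag [simp]:
  "dim_row (block_diag X Y) = dim_row X + dim_row Y" "dim_col (block_diag X Y) = dim_col X + dim_col Y"
  by (auto simp: block_diag_def)

lemma block_diag_eq:
  "X \<in> carrier_mat a b \<Longrightarrow> Y \<in> carrier_mat c d \<Longrightarrow>
    block_diag X Y = four_block_mat X (0\<^sub>m a d) (0\<^sub>m c b) Y"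
  by (auto simp: block_diag_def)

lemma block_diag_assoc: "block_diag X (block_diag Y Z) = block_diag (block_diag X Y) Z"
  using assoc_four_block_mat[of X Y Z] by (simp only: block_diag_def)

lemma block_diag_one [simp]: "block_diag (1\<^sub>m a) (1\<^sub>m b) = 1\<^sub>m (a + b)"
  by (simp add: block_diag_def)

lemma block_diag_mult:
  fixes X :: "'a::comm_ring_1 mat"
  assumes "X \<in> carrier_mat a b" "X' \<in> carrier_mat b c" "Y \<in> carrier_mat d e" "Y' \<in> carrier_mat e f"
  shows "block_diag X Y * block_diag X' Y' = block_diag (X * X') (Y * Y')"
  using assms
  by (simp add: block_diag_eq[of _ a b _ d e] block_diag_eq[of _ b c _ e f]
      block_diag_eq[of _ a c _ d f] mult_four_block_mat[of _ a b _ e _ d _ _ c _ f])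

lemma transpose_block_diag:
  "(block_diag X Y)\<^sup>T = block_diag X\<^sup>T Y\<^sup>T"
  unfolding block_diag_def
  by (subst transpose_four_block_mat[of _ "dim_row X" "dim_col X" _ "dim_col Y" _ "dim_row Y"]) auto

lemma det_block_diag:
  fixes X :: "'a::idom mat"
  assumes "X \<in> carrier_mat a a" "Y \<in> carrier_mat b b"
  shows "det (block_diag X Y) = det X * det Y"
  using assms by (subst block_diag_eq[OF assms]) (auto intro!: det_four_block_mat_upper_right_zero)

lemma minus_four_block_mat:
  assumes "A1 \<in> carrier_mat nr1 nc1" "B1 \<in> carrier_mat nr1 nc2"
    "C1 \<in> carrier_mat nr2 nc1" "D1 \<in> carrier_mat nr2 nc2"
    "A2 \<in> carrier_mat nr1 nc1" "B2 \<in> carrier_mat nr1 nc2"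
    "C2 \<in> carrier_mat nr2 nc1" "D2 \<in> carrier_mat nr2 nc2"
  shows "four_block_mat A1 B1 C1 D1 - four_block_mat A2 B2 C2 D2
    = four_block_mat (A1 - A2) (B1 - B2) (C1 - C2) (D1 - D2)"
  by (rule eq_matI, insert assms, auto)

lemma uminus_zero_mat [simp]: "- 0\<^sub>m a b = (0\<^sub>m a b :: 'a::group_add mat)"
  by (intro eq_matI) auto

text \<open>Blocks of width or height 0 let \<^const>\<open>four_block_mat\<close> stack two matrices.\<close>
lemma block_diag_one_four_block_mat:
  assumes "X \<in> carrier_mat a a" "Y \<in> carrier_mat a b" "Z \<in> carrier_mat b a" "W \<in> carrier_mat b b"
  shows "block_diag (1\<^sub>m n) (four_block_mat X Y Z W) =
    four_block_mat (block_diag (1\<^sub>m n) X) (four_block_mat (0\<^sub>m n b) (0\<^sub>m n 0) Y (0\<^sub>m a 0))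
      (four_block_mat (0\<^sub>m b n) Z (0\<^sub>m 0 n) (0\<^sub>m 0 a)) W"
  (is "?L = ?R")
  using assms by (intro eq_matI) (auto simp: block_diag_def)

section \<open>Block elimination of one coefficient\<close>

text \<open>With \<open>Q\<close> cut into blocks \<open>Q1\<close> to \<open>Q4\<close>, the upper
  left corner of the difference is \<open>[G, -Q1; -I, xI]\<close>. The row operation
  \<open>[0, -I; I, G]\<close> turns it into \<open>[I, -xI; 0, xG - Q1]\<close>, and the column
  operation \<open>[I, xI; 0, I]\<close> clears the remaining off-diagonal entry.\<close>

lemma elimination_left:
  fixes P :: "'a::comm_ring_1 mat" and x :: 'a
  assumes P: "P \<in> carrier_mat n n" and A: "A \<in> carrier_mat n n"
    and Q: "Q \<in> carrier_mat (n + k) (n + k)" and D: "D \<in> carrier_mat k k"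
  defines "G \<equiv> x \<cdot>\<^sub>m P + A"
  shows "block_diag (four_block_mat (0\<^sub>m n n) (- 1\<^sub>m n) (1\<^sub>m n) G) (1\<^sub>m k)
      * (block_diag (x \<cdot>\<^sub>m P) (block_diag (x \<cdot>\<^sub>m 1\<^sub>m n) D)
         - block_diag (four_block_mat (- A) (1\<^sub>m n) (1\<^sub>m n) (0\<^sub>m n n)) (1\<^sub>m k) * block_diag (1\<^sub>m n) Q)
      * block_diag (four_block_mat (1\<^sub>m n) (x \<cdot>\<^sub>m 1\<^sub>m n) (0\<^sub>m n n) (1\<^sub>m n)) (1\<^sub>m k)
    = block_diag (1\<^sub>m n) (block_diag (x \<cdot>\<^sub>m G) D - Q)"
proof -
  obtain Q1 Q2 Q3 Q4 where "split_block Q n n = (Q1, Q2, Q3, Q4)"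
    by (metis prod_cases4)
  from split_block[OF this, of k k] Q
  have q: "Q1 \<in> carrier_mat n n" "Q2 \<in> carrier_mat n k" "Q3 \<in> carrier_mat k n" "Q4 \<in> carrier_mat k k"
    and Q_eq: "Q = four_block_mat Q1 Q2 Q3 Q4"
    by auto
  have G: "G \<in> carrier_mat n n"
    using P A by (simp add: G_def)
  note c = P A D q G
  let ?z = "0\<^sub>m n n :: 'a mat" and ?o = "1\<^sub>m n :: 'a mat" and ?c = "0\<^sub>m n 0 :: 'a mat"
    and ?r = "0\<^sub>m 0 n :: 'a mat" and ?s = "0\<^sub>m 0 0 :: 'a mat"
  let ?w = "four_block_mat (- A) ?o ?o ?z" and ?u = "four_block_mat ?z (- ?o) ?o G"
    and ?v = "four_block_mat ?o (x \<cdot>\<^sub>m ?o) ?z ?o"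
  let ?col = "\<lambda>Y Z. four_block_mat Y ?c Z ?c :: 'a mat"
    and ?row = "\<lambda>Y Z. four_block_mat Y Z ?r ?r :: 'a mat"
  have lead: "block_diag (x \<cdot>\<^sub>m P) (block_diag (x \<cdot>\<^sub>m ?o) D) =
      four_block_mat (four_block_mat (x \<cdot>\<^sub>m P) ?z ?z (x \<cdot>\<^sub>m ?o)) (0\<^sub>m (n + n) k) (0\<^sub>m k (n + n)) D"
    using c by (simp add: block_diag_assoc block_diag_eq[of _ n n _ n n] block_diag_eq[of _ "n+n" "n+n" _ k k])
  have bd: "block_diag X (1\<^sub>m k) = four_block_mat X (0\<^sub>m (n + n) k) (0\<^sub>m k (n + n)) (1\<^sub>m k)"
    if "X \<in> carrier_mat (n + n) (n + n)" for X :: "'a mat"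
    using that by (auto intro: block_diag_eq)
  have uc: "?u \<in> carrier_mat (n + n) (n + n)" "?v \<in> carrier_mat (n + n) (n + n)"
    "?w \<in> carrier_mat (n + n) (n + n)"
    using c by auto

  \<comment> \<open>Block products by shape: \<open>sq\<close> within the corner, \<open>ml\<close>
    for corner times stacked column, \<open>mr\<close> for stacked row times corner, and
    \<open>big\<close> for the corner of size \<open>n + n\<close> against the last \<open>k\<close>
    coordinates.\<close>
  note sq = mult_four_block_mat[of _ n n _ n _ n _ _ n _ n]
  note ml = mult_four_block_mat[of _ n n _ n _ n _ _ k _ 0]
  note mr = mult_four_block_mat[of _ k n _ n _ 0 _ _ n _ n]
  note big = mult_four_block_mat[of _ "n+n" "n+n" _ k _ k _ _ "n+n" _ k]
  note big_minus = minus_four_block_mat[of _ "n+n" "n+n" _ k _ k]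
  have 1: "?w * block_diag ?o Q1 = four_block_mat (- A) Q1 ?o ?z"
    using c by (simp add: sq block_diag_eq[of _ n n _ n n])
  have 2: "?w * ?col (0\<^sub>m n k) Q2 = ?col Q2 (0\<^sub>m n k)"
    using c by (simp add: ml)
  \<comment> \<open>The Horner step originates here: \<open>x P - (-A)\<close> is
    \<open>G\<close>.\<close>
  have 3: "four_block_mat (x \<cdot>\<^sub>m P) ?z ?z (x \<cdot>\<^sub>m ?o) - four_block_mat (- A) Q1 ?o ?z
      = four_block_mat G (- Q1) (- ?o) (x \<cdot>\<^sub>m ?o)"
    using c by (subst minus_four_block_mat[of _ n n _ n _ n]) (auto simp: G_def)
  have 4: "0\<^sub>m (n + n) k - ?col Q2 (0\<^sub>m n k) = ?col (- Q2) (0\<^sub>m n k)"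
    using c by (intro eq_matI) auto
  have 5: "0\<^sub>m k (n + n) - ?row (0\<^sub>m k n) Q3 = ?row (0\<^sub>m k n) (- Q3)"
    using c by (intro eq_matI) auto
  have neg: "X + - X = ?z" if "X \<in> carrier_mat n n" for X :: "'a mat"
    using that by (intro eq_matI) auto
  have smult_neg: "x \<cdot>\<^sub>m - ?o = - (x \<cdot>\<^sub>m ?o)"
    by (intro eq_matI) auto
  \<comment> \<open>The lower left entry is \<open>G + G (-I) = 0\<close>, and the upper left one is
    \<open>(-I) (-I) = I\<close>.\<close>
  have "?u * four_block_mat G (- Q1) (- ?o) (x \<cdot>\<^sub>m ?o) = four_block_mat ?o (- (x \<cdot>\<^sub>m ?o)) ?z (x \<cdot>\<^sub>m G - Q1)"
    using c neg by (simp add: smult_neg sq minus_add_uminus_mat[of _ n n] comm_add_mat[of _ n n]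
        mult_smult_distrib[of _ n n _ n])
  moreover have "four_block_mat ?o (- (x \<cdot>\<^sub>m ?o)) ?z (x \<cdot>\<^sub>m G - Q1) * ?v = block_diag ?o (x \<cdot>\<^sub>m G - Q1)"
    using c neg by (subst sq) (auto simp: block_diag_def)
  ultimately have 6: "?u * four_block_mat G (- Q1) (- ?o) (x \<cdot>\<^sub>m ?o) * ?v = block_diag ?o (x \<cdot>\<^sub>m G - Q1)"
    by simp
  \<comment> \<open>On the borders, the row operation moves \<open>-Q2\<close> from the first block
    row to the second. The column operation fixes the bottom row because its first block is
    zero.\<close>
  have 7: "?u * ?col (- Q2) (0\<^sub>m n k) = ?col (0\<^sub>m n k) (- Q2)"
    using c by (simp add: ml)
  have 8: "?row (0\<^sub>m k n) (- Q3) * ?v = ?row (0\<^sub>m k n) (- Q3)"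
    using c by (simp add: mr)
  have WQ: "block_diag ?w (1\<^sub>m k) * block_diag ?o Q =
      four_block_mat (four_block_mat (- A) Q1 ?o ?z) (?col Q2 (0\<^sub>m n k)) (?row (0\<^sub>m k n) Q3) Q4"
    unfolding Q_eq block_diag_one_four_block_mat[OF q] bd[OF uc(3)]
    using c by (subst big) (auto simp: 1 2)
  have L: "block_diag (x \<cdot>\<^sub>m P) (block_diag (x \<cdot>\<^sub>m ?o) D) - block_diag ?w (1\<^sub>m k) * block_diag ?o Q
    = four_block_mat (four_block_mat G (- Q1) (- ?o) (x \<cdot>\<^sub>m ?o)) (?col (- Q2) (0\<^sub>m n k)) (?row (0\<^sub>m k n) (- Q3)) (D - Q4)"
    unfolding lead WQ using c by (subst big_minus) (auto simp: 3 4 5)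
  have R: "block_diag (x \<cdot>\<^sub>m G) D - Q = four_block_mat (x \<cdot>\<^sub>m G - Q1) (- Q2) (- Q3) (D - Q4)"
    unfolding Q_eq using c by (subst block_diag_eq[of _ n n _ k k])
     (auto simp: minus_four_block_mat[of _ n n _ k _ k])
  let ?L = "four_block_mat (four_block_mat G (- Q1) (- ?o) (x \<cdot>\<^sub>m ?o)) (?col (- Q2) (0\<^sub>m n k))
    (?row (0\<^sub>m k n) (- Q3)) (D - Q4)"
  have "block_diag ?u (1\<^sub>m k) * ?L = four_block_mat (?u * four_block_mat G (- Q1) (- ?o) (x \<cdot>\<^sub>m ?o))
      (?col (0\<^sub>m n k) (- Q2)) (?row (0\<^sub>m k n) (- Q3)) (D - Q4)"
    unfolding bd[OF uc(1)] using c by (subst big) (auto simp: 7)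
  moreover have "\<dots> * block_diag ?v (1\<^sub>m k) = four_block_mat (block_diag ?o (x \<cdot>\<^sub>m G - Q1))
      (?col (0\<^sub>m n k) (- Q2)) (?row (0\<^sub>m k n) (- Q3)) (D - Q4)"
    unfolding bd[OF uc(2)] using c by (subst big) (auto simp: 6 8)
  moreover have split_R: "block_diag ?o (four_block_mat (x \<cdot>\<^sub>m G - Q1) (- Q2) (- Q3) (D - Q4)) =
      four_block_mat (block_diag ?o (x \<cdot>\<^sub>m G - Q1)) (?col (0\<^sub>m n k) (- Q2))
        (?row (0\<^sub>m k n) (- Q3)) (D - Q4)"
    using c by (intro block_diag_one_four_block_mat) auto
  ultimately show ?thesis
    unfolding L R by (simp only: split_R)
qed

lemma transpose_eqD: "A\<^sup>T = B\<^sup>T \<Longrightarrow> A = (B :: 'a mat)"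
  using transpose_transpose[of A] transpose_transpose[of B] by simp

text \<open>Transposition reduces this to the case where the Fiedler factor is on the left.\<close>
lemma elimination_right:
  fixes P :: "'a::comm_ring_1 mat" and x :: 'a
  assumes P: "P \<in> carrier_mat n n" and A: "A \<in> carrier_mat n n"
    and Q: "Q \<in> carrier_mat (n + k) (n + k)" and D: "D \<in> carrier_mat k k"
  defines "G \<equiv> x \<cdot>\<^sub>m P + A"
  shows "block_diag (four_block_mat (1\<^sub>m n) (0\<^sub>m n n) (x \<cdot>\<^sub>m 1\<^sub>m n) (1\<^sub>m n)) (1\<^sub>m k)
      * (block_diag (x \<cdot>\<^sub>m P) (block_diag (x \<cdot>\<^sub>m 1\<^sub>m n) D)
         - block_diag (1\<^sub>m n) Q * block_diag (four_block_mat (- A) (1\<^sub>m n) (1\<^sub>m n) (0\<^sub>m n n)) (1\<^sub>m k))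
      * block_diag (four_block_mat (0\<^sub>m n n) (1\<^sub>m n) (- 1\<^sub>m n) G) (1\<^sub>m k)
    = block_diag (1\<^sub>m n) (block_diag (x \<cdot>\<^sub>m G) D - Q)"
    (is "block_diag ?u _ * (?X - ?Y * ?Z) * block_diag ?v _ = ?R")
proof -
  have tm: "(y \<cdot>\<^sub>m M)\<^sup>T = y \<cdot>\<^sub>m M\<^sup>T" "(- M)\<^sup>T = - M\<^sup>T" for y :: 'a and M
    by (auto intro!: eq_matI)
  have G: "G \<in> carrier_mat n n"
    using P A by (simp add: G_def)
  have W: "block_diag (x \<cdot>\<^sub>m G) D \<in> carrier_mat (n + k) (n + k)"
    using G D by auto
  note t = transpose_four_block_mat[of _ n n _ n _ n] transpose_block_diag tm
  have "?X \<in> carrier_mat (n + (n + k)) (n + (n + k))" "?Y \<in> carrier_mat (n + (n + k)) (n + (n + k))"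
    using P Q D by (intro block_diag_carrier; simp)+
  moreover have "block_diag W (1\<^sub>m k) \<in> carrier_mat (n + n + k) (n + n + k)"
    if "W \<in> carrier_mat (n + n) (n + n)" for W :: "'a mat"
    using that by (intro block_diag_carrier) simp_all
  moreover have "?u \<in> carrier_mat (n + n) (n + n)" "?v \<in> carrier_mat (n + n) (n + n)"
    "four_block_mat (- A) (1\<^sub>m n) (1\<^sub>m n) (0\<^sub>m n n) \<in> carrier_mat (n + n) (n + n)"
    using A G by (intro four_block_carrier_mat; simp)+
  ultimately have c: "block_diag ?u (1\<^sub>m k) \<in> carrier_mat (n + n + k) (n + n + k)"
    "block_diag ?v (1\<^sub>m k) \<in> carrier_mat (n + n + k) (n + n + k)"
    "?X \<in> carrier_mat (n + n + k) (n + n + k)" "?Y \<in> carrier_mat (n + n + k) (n + n + k)"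
    "?Z \<in> carrier_mat (n + n + k) (n + n + k)"
    unfolding add.assoc by blast+
  \<comment> \<open>Transposition exchanges the outer factors \<open>U\<close> and \<open>V\<close>
    and brings the Fiedler factor \<open>Z\<close> to the left.\<close>
  have rev: "(U * (X - Y * Z) * V)\<^sup>T = V\<^sup>T * (X\<^sup>T - Z\<^sup>T * Y\<^sup>T) * U\<^sup>T"
    if "U \<in> carrier_mat N N" "V \<in> carrier_mat N N" "X \<in> carrier_mat N N"
      "Y \<in> carrier_mat N N" "Z \<in> carrier_mat N N" for U V X Y Z :: "'a mat" and N
  proof -
    have YZ: "Y * Z \<in> carrier_mat N N" and XYZ: "X - Y * Z \<in> carrier_mat N N"
      using that by auto
    have "(U * (X - Y * Z) * V)\<^sup>T = V\<^sup>T * ((X - Y * Z)\<^sup>T * U\<^sup>T)"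
      using transpose_mult[OF mult_carrier_mat[OF that(1) XYZ] that(2)] transpose_mult[OF that(1) XYZ] by simp
    also have "(X - Y * Z)\<^sup>T = X\<^sup>T - Z\<^sup>T * Y\<^sup>T"
      using transpose_minus[OF that(3) YZ] transpose_mult[OF that(4,5)] by simp
    finally show ?thesis
      using that by (simp add: assoc_mult_mat[of "V\<^sup>T" N N "X\<^sup>T - Z\<^sup>T * Y\<^sup>T" N "U\<^sup>T" N]
          minus_carrier_mat[OF mult_carrier_mat[of "Z\<^sup>T" N N "Y\<^sup>T" N]])
  qed
  have "(block_diag ?u (1\<^sub>m k) * (?X - ?Y * ?Z) * block_diag ?v (1\<^sub>m k))\<^sup>T
      = (block_diag ?v (1\<^sub>m k))\<^sup>T * (?X\<^sup>T - ?Z\<^sup>T * ?Y\<^sup>T) * (block_diag ?u (1\<^sub>m k))\<^sup>T"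
    by (rule rev[OF c])
  \<comment> \<open>The transposed factors have exactly the form in \<open>elimination_left\<close>
    for \<open>P\<^sup>T\<close>, \<open>A\<^sup>T\<close>, \<open>Q\<^sup>T\<close>,
    \<open>D\<^sup>T\<close>; in particular \<open>[0, I; -I, G]\<close> becomes
    \<open>[0, -I; I, G\<^sup>T]\<close>.\<close>
  also have "\<dots> = block_diag (1\<^sub>m n) (block_diag (x \<cdot>\<^sub>m (x \<cdot>\<^sub>m P\<^sup>T + A\<^sup>T)) D\<^sup>T - Q\<^sup>T)"
    using elimination_left[of "P\<^sup>T" n "A\<^sup>T" "Q\<^sup>T" k "D\<^sup>T" x] P Q A D G
    by (simp add: t G_def transpose_add[of _ n n])
  also have "\<dots> = ?R\<^sup>T"
    unfolding transpose_block_diag transpose_minus[OF W Q]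
    using P A by (simp add: tm G_def transpose_add[of _ n n])
  finally show ?thesis
    by (rule transpose_eqD)
qed


section \<open>Equivalence by transformations that fix the last \<open>r\<close> coordinates\<close>

text \<open>Determinant 1 makes sense over every integral domain, is preserved under products, and
  over complex polynomials implies unimodularity.\<close>

definition sys_equiv :: "nat \<Rightarrow> nat \<Rightarrow> 'a::idom mat \<Rightarrow> 'a mat \<Rightarrow> bool" where
  "sys_equiv N r X Y \<longleftrightarrow> (\<exists>U\<in>carrier_mat N N. \<exists>V\<in>carrier_mat N N. det U = 1 \<and> det V = 1 \<and>
     block_diag U (1\<^sub>m r) * X * block_diag V (1\<^sub>m r) = Y)"

lemma sys_equivI:
  assumes "U \<in> carrier_mat N N" "V \<in> carrier_mat N N" "det U = 1" "det V = 1"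
    "block_diag U (1\<^sub>m r) * X * block_diag V (1\<^sub>m r) = Y"
  shows "sys_equiv N r X Y"
  using assms unfolding sys_equiv_def by blast

lemma sys_equiv_refl:
  "X \<in> carrier_mat (N + r) (N + r) \<Longrightarrow> sys_equiv N r X X"
  by (rule sys_equivI[of "1\<^sub>m N" _ "1\<^sub>m N"]) auto

lemma sys_equiv_trans:
  assumes X: "X \<in> carrier_mat (N + r) (N + r)"
    and "sys_equiv N r X Y" "sys_equiv N r Y Z"
  shows "sys_equiv N r X Z"
proof -
  obtain U V where U: "U \<in> carrier_mat N N" "V \<in> carrier_mat N N" "det U = 1" "det V = 1"
    and Y: "block_diag U (1\<^sub>m r) * X * block_diag V (1\<^sub>m r) = Y"
    using assms(2) unfolding sys_equiv_def by blast
  obtain U' V' where U': "U' \<in> carrier_mat N N" "V' \<in> carrier_mat N N" "det U' = 1" "det V' = 1"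
    and Z: "block_diag U' (1\<^sub>m r) * Y * block_diag V' (1\<^sub>m r) = Z"
    using assms(3) unfolding sys_equiv_def by blast
  have c: "block_diag W (1\<^sub>m r) \<in> carrier_mat (N + r) (N + r)" if "W \<in> carrier_mat N N" for W :: "'a mat"
    using that by auto
  have "block_diag (U' * U) (1\<^sub>m r) * X * block_diag (V * V') (1\<^sub>m r)
      = block_diag U' (1\<^sub>m r) * block_diag U (1\<^sub>m r) * X * (block_diag V (1\<^sub>m r) * block_diag V' (1\<^sub>m r))"
    using U U' by (simp add: block_diag_mult[of _ N N _ N _ r r _ r])
  also have "\<dots> = Z"
    unfolding Z[symmetric] Y[symmetric]
    using X c[OF U(1)] c[OF U(2)] c[OF U'(1)] c[OF U'(2)]
    by (simp add: assoc_mult_mat[of _ "N+r" "N+r" _ "N+r" _ "N+r"] mult_carrier_mat[of _ "N+r" "N+r"])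
  finally show ?thesis
    using U U' by (intro sys_equivI[of "U' * U" N "V * V'"]) (auto simp: det_mult[of _ N])
qed

text \<open>Padding \<open>U\<close> and \<open>V\<close> by an identity keeps their determinants,
  so a reduction can continue below identity blocks that are already split off.\<close>

lemma sys_equiv_block_diag_one:
  assumes X: "X \<in> carrier_mat (N + r) (N + r)" and "sys_equiv N r X Y"
  shows "sys_equiv (k + N) r (block_diag (1\<^sub>m k) X) (block_diag (1\<^sub>m k) Y)"
proof -
  obtain U V where U: "U \<in> carrier_mat N N" "V \<in> carrier_mat N N" "det U = 1" "det V = 1"
    and Y: "block_diag U (1\<^sub>m r) * X * block_diag V (1\<^sub>m r) = Y"
    using assms(2) unfolding sys_equiv_def by blast
  have c: "block_diag W (1\<^sub>m r) \<in> carrier_mat (N + r) (N + r)" if "W \<in> carrier_mat N N" for W :: "'a mat"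
    using that by auto
  have "block_diag (block_diag (1\<^sub>m k) U) (1\<^sub>m r) * block_diag (1\<^sub>m k) X * block_diag (block_diag (1\<^sub>m k) V) (1\<^sub>m r)
    = block_diag (1\<^sub>m k) Y"
    unfolding Y[symmetric] block_diag_assoc[symmetric]
    using X c[OF U(1)] c[OF U(2)]
    by (simp add: block_diag_mult[of _ k k _ k _ "N+r" "N+r" _ "N+r"] mult_carrier_mat[of _ "N+r" "N+r"])
  then show ?thesis
    using U by (intro sys_equivI) (auto simp: det_block_diag[of _ k _ N])
qed

text \<open>In the first two cases the identity block commutes with \<open>G\<close>, and the
  determinant reduces to that of \<open>0 - (-I) = I\<close>. The minus sign in one off-diagonal
  block prevents the value \<open>(-1)^n\<close>. The other two matrices are block
  triangular.\<close>

lemma det_elimination_factors: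
  fixes G :: "'a::idom mat"
  assumes G: "G \<in> carrier_mat n n"
  shows "det (four_block_mat (0\<^sub>m n n) (- 1\<^sub>m n) (1\<^sub>m n) G) = 1"
    "det (four_block_mat (0\<^sub>m n n) (1\<^sub>m n) (- 1\<^sub>m n) G) = 1"
    "det (four_block_mat (1\<^sub>m n) G (0\<^sub>m n n) (1\<^sub>m n)) = 1"
    "det (four_block_mat (1\<^sub>m n) (0\<^sub>m n n) G (1\<^sub>m n)) = 1"
proof -
  have *: "0\<^sub>m n n - - 1\<^sub>m n = (1\<^sub>m n :: 'a mat)"
    by (intro eq_matI) auto
  show "det (four_block_mat (0\<^sub>m n n) (- 1\<^sub>m n) (1\<^sub>m n) G) = 1"
    "det (four_block_mat (0\<^sub>m n n) (1\<^sub>m n) (- 1\<^sub>m n) G) = 1"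
    using G by (subst det_four_block_mat; simp add: *)+
  show "det (four_block_mat (1\<^sub>m n) G (0\<^sub>m n n) (1\<^sub>m n)) = 1"
    using G by (subst det_four_block_mat_lower_left_zero[of _ n _ n]) auto
  show "det (four_block_mat (1\<^sub>m n) (0\<^sub>m n n) G (1\<^sub>m n)) = 1"
    using G by (subst det_four_block_mat_upper_right_zero[of _ n _ n]) auto
qed

text \<open>Both positions of the Fiedler factor lead to the same smaller pencil, so later arguments
  need not record on which side it stood.\<close>

lemma sys_equiv_elimination:
  fixes P :: "'a::idom mat" and x :: 'a
  assumes P: "P \<in> carrier_mat n n" and A: "A \<in> carrier_mat n n"
    and Q: "Q \<in> carrier_mat (n + (s + r)) (n + (s + r))" and D: "D \<in> carrier_mat (s + r) (s + r)"
    and M: "M = block_diag (four_block_mat (- A) (1\<^sub>m n) (1\<^sub>m n) (0\<^sub>m n n)) (1\<^sub>m (s + r))"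
    and T: "T = M * block_diag (1\<^sub>m n) Q \<or> T = block_diag (1\<^sub>m n) Q * M"
  shows "sys_equiv (n + (n + s)) r
      (block_diag (x \<cdot>\<^sub>m P) (block_diag (x \<cdot>\<^sub>m 1\<^sub>m n) D) - T)
      (block_diag (1\<^sub>m n) (block_diag (x \<cdot>\<^sub>m (x \<cdot>\<^sub>m P + A)) D - Q))"
proof -
  have G: "x \<cdot>\<^sub>m P + A \<in> carrier_mat n n"
    using P A by auto
  \<comment> \<open>The operations act on the first \<open>n + n\<close> coordinates only; the
    identity behind them is cut so that \<open>s\<close> of its rows join \<open>U\<close> and
    \<open>V\<close> and the last \<open>r\<close> stay fixed.\<close>
  have split: "block_diag W (1\<^sub>m (s + r)) = block_diag (block_diag W (1\<^sub>m s)) (1\<^sub>m r)" for W :: "'a mat"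
    by (simp flip: block_diag_assoc)
  have c: "four_block_mat X1 X2 X3 X4 \<in> carrier_mat (n + n) (n + n)"
    if "X1 \<in> carrier_mat n n" "X4 \<in> carrier_mat n n" for X1 X2 X3 X4 :: "'a mat"
    using that by auto
  have bc: "block_diag W (1\<^sub>m s) \<in> carrier_mat (n + (n + s)) (n + (n + s))"
    "det (block_diag W (1\<^sub>m s)) = det W"
    if "W \<in> carrier_mat (n + n) (n + n)" for W :: "'a mat"
    using that by (auto simp: det_block_diag[of _ "n + n" _ s])
  let ?G = "x \<cdot>\<^sub>m P + A"
  from T show ?thesis
  proof
    assume "T = M * block_diag (1\<^sub>m n) Q"
    with elimination_left[OF P A Q D, of x] G show ?thesis
      by (intro sys_equivI[of "block_diag (four_block_mat (0\<^sub>m n n) (- 1\<^sub>m n) (1\<^sub>m n) ?G) (1\<^sub>m s)" _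
            "block_diag (four_block_mat (1\<^sub>m n) (x \<cdot>\<^sub>m 1\<^sub>m n) (0\<^sub>m n n) (1\<^sub>m n)) (1\<^sub>m s)"])
        (simp_all add: M bc c det_elimination_factors flip: split)
  next
    assume "T = block_diag (1\<^sub>m n) Q * M"
    with elimination_right[OF P A Q D, of x] G show ?thesis
      by (intro sys_equivI[of "block_diag (four_block_mat (1\<^sub>m n) (0\<^sub>m n n) (x \<cdot>\<^sub>m 1\<^sub>m n) (1\<^sub>m n)) (1\<^sub>m s)" _
            "block_diag (four_block_mat (0\<^sub>m n n) (1\<^sub>m n) (- 1\<^sub>m n) ?G) (1\<^sub>m s)"])
        (simp_all add: M bc c det_elimination_factors flip: split)
  qed
qed

section \<open>Constant matrices as polynomial matrices\<close>

lemma const_pm_mult: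
  assumes "X \<in> carrier_mat a b" "Y \<in> carrier_mat b c"
  shows "const_pm (X * Y) = const_pm X * const_pm Y"
proof -
  interpret semiring_hom "\<lambda>a::complex. [:a:]"
    by unfold_locales (auto simp: one_pCons)
  show ?thesis
    unfolding const_pm_def by (rule mat_hom_mult[OF assms])
qed

lemma const_pm_carrier [simp]: "const_pm X \<in> carrier_mat a b \<longleftrightarrow> X \<in> carrier_mat a b"
  by (simp add: const_pm_def)

lemma const_pm_one [simp]: "const_pm (1\<^sub>m k) = 1\<^sub>m k"
  by (auto simp: const_pm_def one_pCons intro!: eq_matI)

lemma const_pm_zero [simp]: "const_pm (0\<^sub>m a b) = 0\<^sub>m a b"
  by (auto simp: const_pm_def intro!: eq_matI)

lemma const_pm_uminus: "const_pm (- X) = - const_pm X"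
  by (auto simp: const_pm_def intro!: eq_matI)

lemma const_pm_four_block_mat:
  assumes "X \<in> carrier_mat a b" "Y \<in> carrier_mat a d" "Z \<in> carrier_mat c b" "W \<in> carrier_mat c d"
  shows "const_pm (four_block_mat X Y Z W) = four_block_mat (const_pm X) (const_pm Y) (const_pm Z) (const_pm W)"
  unfolding const_pm_def by (rule map_four_block_mat[OF assms])

lemma const_pm_block_diag: "const_pm (block_diag X Y) = block_diag (const_pm X) (const_pm Y)"
proof -
  have "const_pm (block_diag X Y) = four_block_mat (const_pm X) (const_pm (0\<^sub>m (dim_row X) (dim_col Y)))
      (const_pm (0\<^sub>m (dim_row Y) (dim_col X))) (const_pm Y)"
    unfolding block_diag_def by (rule const_pm_four_block_mat) auto
  then show ?thesis
    by (simp add: block_diag_def const_pm_def[of X] const_pm_def[of Y])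
qed

lemma lam_pm_conv_const_pm: "lam_pm X = monom 1 1 \<cdot>\<^sub>m const_pm X"
  by (auto simp: lam_pm_def const_pm_def smult_monom monom_Suc monom_0 intro!: eq_matI)

lemma smult_block_diag: "x \<cdot>\<^sub>m block_diag X Y = block_diag (x \<cdot>\<^sub>m X) (x \<cdot>\<^sub>m Y)"
  for x :: "'a::comm_ring_1"
  by (auto simp: block_diag_def intro!: eq_matI)

lemma block_diag_one_0 [simp]: "block_diag (1\<^sub>m 0) X = X"
  by (auto simp: block_diag_def intro!: eq_matI)

section \<open>Fiedler factors and their products\<close>

text \<open>The degree is left open because the induction lowers it while keeping the same
  coefficients; the sizes of the \<open>A j\<close> are therefore assumed up to the current index in
  each lemma.\<close>

locale system_data =
  fixes n r :: nat and A :: "nat \<Rightarrow> complex mat" and C B Ap E :: "complex mat"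
  assumes C: "C \<in> carrier_mat n r" and B: "B \<in> carrier_mat r n"
    and Ap: "Ap \<in> carrier_mat r r" and E: "E \<in> carrier_mat r r"
begin

abbreviation S :: "nat \<Rightarrow> nat \<Rightarrow> complex mat" where
  "S m \<equiv> sys_fiedler_M n m r A C B Ap E"

text \<open>The order of the factors is a list of indices, so that eliminating a coefficient amounts
  to deleting a list entry.\<close>

definition fiedler_prod :: "nat \<Rightarrow> nat list \<Rightarrow> complex mat" where
  "fiedler_prod m ks = foldr (\<lambda>k acc. S m k * acc) ks (1\<^sub>m (n * m + r))"

lemma S_0:
  assumes "A 0 \<in> carrier_mat n n"
  shows "S (Suc k) 0 = four_block_mat (block_diag (1\<^sub>m (k * n)) (- A 0))
    (- em_kron_col n (Suc k) C) (- em_kron_row n (Suc k) B) (- Ap)"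
  by (simp add: sys_fiedler_M_def fiedler_M_def)

text \<open>The position of a non-leading factor's nontrivial block is counted from the lower end,
  so raising the degree only adds an identity block at the top. For \<open>i = 0\<close> the blocks
  of \<open>C\<close> and \<open>B\<close> sit in the last block row and column and are shifted
  along.\<close>

lemma S_shift:
  assumes "i < m" "A i \<in> carrier_mat n n"
  shows "S (Suc m) i = block_diag (1\<^sub>m n) (S m i)"
proof (cases "i = 0")
  case True
  obtain k where m: "m = Suc k"
    using assms(1) by (cases m) auto
  have k: "block_diag (1\<^sub>m (Suc k * n)) (- A 0) = block_diag (1\<^sub>m n) (block_diag (1\<^sub>m (k * n)) (- A 0))"
    by (simp add: block_diag_assoc)
  have c: "block_diag (1\<^sub>m (k * n)) (- A 0) \<in> carrier_mat (k * n + n) (k * n + n)"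
    using assms True by auto
  \<comment> \<open>The borders are brought into the stacked form of
    \<open>block_diag_one_four_block_mat\<close>: \<open>n\<close> zero rows above the old column,
    and below \<open>n\<close> zero columns before the old row.\<close>
  have col: "- em_kron_col n (Suc m) C = four_block_mat (0\<^sub>m n r) (0\<^sub>m n 0) (- em_kron_col n m C) (0\<^sub>m (k * n + n) 0)"
  proof (rule eq_matI)
    fix i j
    assume "i < dim_row (four_block_mat (0\<^sub>m n r) (0\<^sub>m n 0) (- em_kron_col n m C) (0\<^sub>m (k * n + n) 0))"
      and "j < dim_col (four_block_mat (0\<^sub>m n r) (0\<^sub>m n 0) (- em_kron_col n m C) (0\<^sub>m (k * n + n) 0))"
    then have ij: "i < n + (k * n + n)" "j < r"
      using C by (auto simp: em_kron_col_def m mult.commute)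
    show "(- em_kron_col n (Suc m) C) $$ (i, j) =
        four_block_mat (0\<^sub>m n r) (0\<^sub>m n 0) (- em_kron_col n m C) (0\<^sub>m (k * n + n) 0) $$ (i, j)"
    proof (cases "i < n")
      case True
      then show ?thesis
        using ij C by (auto simp: em_kron_col_def m)
    next
      case False
      then have "i - n - k * n = i - (n + k * n)" "k * n \<le> i - n \<longleftrightarrow> n + k * n \<le> i"
        by auto
      with False show ?thesis
        using ij C by (auto simp: em_kron_col_def m mult.commute[of n])
    qed
  qed (use C in \<open>auto simp: em_kron_col_def m mult.commute\<close>)
  have row: "- em_kron_row n (Suc m) B = four_block_mat (0\<^sub>m r n) (- em_kron_row n m B) (0\<^sub>m 0 n) (0\<^sub>m 0 (k * n + n))"
  proof (rule eq_matI)
    fix j i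
    assume "j < dim_row (four_block_mat (0\<^sub>m r n) (- em_kron_row n m B) (0\<^sub>m 0 n) (0\<^sub>m 0 (k * n + n)))"
      and "i < dim_col (four_block_mat (0\<^sub>m r n) (- em_kron_row n m B) (0\<^sub>m 0 n) (0\<^sub>m 0 (k * n + n)))"
    then have ij: "i < n + (k * n + n)" "j < r"
      using B by (auto simp: em_kron_row_def m mult.commute)
    show "(- em_kron_row n (Suc m) B) $$ (j, i) =
        four_block_mat (0\<^sub>m r n) (- em_kron_row n m B) (0\<^sub>m 0 n) (0\<^sub>m 0 (k * n + n)) $$ (j, i)"
    proof (cases "i < n")
      case True
      then show ?thesis
        using ij B by (auto simp: em_kron_row_def m)
    next
      case False
      then have "i - n - k * n = i - (n + k * n)" "k * n \<le> i - n \<longleftrightarrow> n + k * n \<le> i"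
        by auto
      with False show ?thesis
        using ij B by (auto simp: em_kron_row_def m mult.commute[of n])
    qed
  qed (use B in \<open>auto simp: em_kron_row_def m mult.commute\<close>)
  have "block_diag (1\<^sub>m n) (S m 0) = S (Suc m) 0"
    unfolding m S_0[OF assms(2)[unfolded True]] k col[unfolded m] row[unfolded m]
    using c C B Ap
    by (intro block_diag_one_four_block_mat)
      (auto simp: em_kron_col_def em_kron_row_def mult.commute)
  then show ?thesis
    by (simp add: True)
next
  case False
  \<comment> \<open>Truncated subtraction: this uses \<open>i < m\<close>.\<close>
  have "(Suc m - i - 1) * n = n + (m - i - 1) * n"
    using assms(1) by (cases "m - i") (auto simp: Suc_diff_le)
  then have "1\<^sub>m ((Suc m - i - 1) * n) = (block_diag (1\<^sub>m n) (1\<^sub>m ((m - i - 1) * n)) :: complex mat)"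
    by simp
  moreover have "S m' i = block_diag (block_diag (1\<^sub>m ((m' - i - 1) * n)) (block_diag
      (four_block_mat (- A i) (1\<^sub>m n) (1\<^sub>m n) (0\<^sub>m n n)) (1\<^sub>m ((i - 1) * n)))) (1\<^sub>m r)"
    if "i < m'" for m'
    using False that by (simp add: sys_fiedler_M_def fiedler_M_def)
  ultimately show ?thesis
    using assms(1) by (simp only: less_SucI block_diag_assoc)
qed

text \<open>For the highest non-leading index the identity in front has size
  \<open>(Suc m - m - 1) * n = 0\<close>, so the nontrivial block stands at the top. Index 0 has a
  different shape, hence \<open>0 < m\<close>.\<close>

lemma S_top:
  assumes "0 < m"
  shows "S (Suc m) m = block_diag (four_block_mat (- A m) (1\<^sub>m n) (1\<^sub>m n) (0\<^sub>m n n)) (1\<^sub>m (n * (m - 1) + r))"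
  using assms by (simp add: sys_fiedler_M_def fiedler_M_def mult.commute flip: block_diag_assoc)

lemma S_carrier:
  assumes "i < m" "A i \<in> carrier_mat n n"
  shows "S m i \<in> carrier_mat (n * m + r) (n * m + r)"
  using assms
proof (induction m)
  case (Suc m)
  show ?case
  proof (cases "i = m")
    case True
    show ?thesis
    proof (cases m)
      case 0
      then show ?thesis
        using True Suc.prems Ap unfolding \<open>i = m\<close> 0 S_0[OF Suc.prems(2)[unfolded \<open>i = m\<close> 0]]
        by (intro carrier_matI) (auto)
    next
      case (Suc k)
      then show ?thesis
        using True Suc.prems S_top[of m] by (auto intro!: carrier_matI simp: algebra_simps)
    qed
  next
    case False
    then have "S m i \<in> carrier_mat (n * m + r) (n * m + r)"
      using Suc by simp
    moreover have "S (Suc m) i = block_diag (1\<^sub>m n) (S m i)"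
      using False Suc.prems by (intro S_shift) auto
    ultimately show ?thesis
      using block_diag_carrier[of "1\<^sub>m n" n n "S m i"] by (simp add: add.assoc)
  qed
qed simp

text \<open>The top factor acts only on the first \<open>n + n\<close> coordinates, where a factor
  of index at most \<open>m - 2\<close> is the identity, by two applications of
  \<open>S_shift\<close>.\<close>

lemma S_top_commute:
  assumes "Suc i < m" and A: "\<And>j. j \<le> m \<Longrightarrow> A j \<in> carrier_mat n n"
  shows "S (Suc m) m * S (Suc m) i = S (Suc m) i * S (Suc m) m"
proof -
  obtain k where m: "m = Suc k" and i: "i < k"
    using assms(1) by (cases m) auto
  have "S (Suc m) i = block_diag (1\<^sub>m (n + n)) (S k i)"
    using S_shift[of i m] S_shift[of i k] A[of i] i m by (simp add: block_diag_assoc)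
  moreover have "S k i \<in> carrier_mat (n * k + r) (n * k + r)"
    using A[of i] i m by (intro S_carrier) auto
  moreover have F: "four_block_mat (- A m) (1\<^sub>m n) (1\<^sub>m n) (0\<^sub>m n n) \<in> carrier_mat (n + n) (n + n)"
    using A[of m] by auto
  ultimately show ?thesis
    using S_top[of m] m left_mult_one_mat[OF F] right_mult_one_mat[OF F]
    by (simp add: block_diag_mult[of _ "n+n" "n+n" _ "n+n" _ "n * k + r" "n * k + r" _ "n * k + r"])
qed

lemma fiedler_prod_simps [simp]:
  "fiedler_prod m [] = 1\<^sub>m (n * m + r)"
  "fiedler_prod m (k # ks) = S m k * fiedler_prod m ks"
  by (simp_all add: fiedler_prod_def)

lemma fiedler_prod_carrier:
  assumes "set ks \<subseteq> {..<m}" "\<And>j. j < m \<Longrightarrow> A j \<in> carrier_mat n n"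
  shows "fiedler_prod m ks \<in> carrier_mat (n * m + r) (n * m + r)"
  using assms(1) by (induction ks) (auto intro!: mult_carrier_mat S_carrier assms(2))

lemma fiedler_prod_append:
  assumes "set (ks @ ls) \<subseteq> {..<m}" "\<And>j. j < m \<Longrightarrow> A j \<in> carrier_mat n n"
  shows "fiedler_prod m (ks @ ls) = fiedler_prod m ks * fiedler_prod m ls"
  using assms(1)
proof (induction ks)
  case Nil
  then show ?case
    using fiedler_prod_carrier[of ls m] assms(2) by simp
next
  case (Cons k ks)
  then have "S m k \<in> carrier_mat (n * m + r) (n * m + r)"
    using assms(2) by (intro S_carrier) auto
  moreover have "fiedler_prod m ks \<in> carrier_mat (n * m + r) (n * m + r)"
    "fiedler_prod m ls \<in> carrier_mat (n * m + r) (n * m + r)"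
    using Cons.prems assms(2) by (auto intro!: fiedler_prod_carrier)
  ultimately show ?case
    using Cons by (simp add: assoc_mult_mat[of _ "n * m + r" "n * m + r" _ "n * m + r" _ "n * m + r"])
qed

lemma fiedler_prod_commute:
  assumes M: "M \<in> carrier_mat (n * m + r) (n * m + r)"
    and "set ks \<subseteq> {..<m}" "\<And>j. j < m \<Longrightarrow> A j \<in> carrier_mat n n"
    and "\<And>k. k \<in> set ks \<Longrightarrow> M * S m k = S m k * M"
  shows "M * fiedler_prod m ks = fiedler_prod m ks * M"
  using assms(2,4)
proof (induction ks)
  case Nil
  then show ?case
    using M by simp
next
  case (Cons k ks)
  let ?N = "n * m + r"
  have S: "S m k \<in> carrier_mat ?N ?N" and P: "fiedler_prod m ks \<in> carrier_mat ?N ?N"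
    using Cons.prems assms(3) by (auto intro!: S_carrier fiedler_prod_carrier)
  have "M * (S m k * fiedler_prod m ks) = M * S m k * fiedler_prod m ks"
    using assoc_mult_mat[OF M S P] by simp
  also have "\<dots> = S m k * (M * fiedler_prod m ks)"
    using Cons.prems assoc_mult_mat[OF S M P] by simp
  also have "\<dots> = S m k * fiedler_prod m ks * M"
    using Cons assoc_mult_mat[OF S P M] by simp
  finally show ?case
    by simp
qed

lemma fiedler_prod_shift:
  assumes "set ks \<subseteq> {..<m}" "\<And>j. j < m \<Longrightarrow> A j \<in> carrier_mat n n"
  shows "fiedler_prod (Suc m) ks = block_diag (1\<^sub>m n) (fiedler_prod m ks)"
  using assms(1)
proof (induction ks)
  case Nil
  then show ?case
    by (simp add: add.assoc)
next
  case (Cons k ks)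
  let ?N = "n * m + r"
  have S: "S m k \<in> carrier_mat ?N ?N" and P: "fiedler_prod m ks \<in> carrier_mat ?N ?N"
    using Cons.prems assms(2) by (auto intro!: S_carrier fiedler_prod_carrier)
  have "S (Suc m) k = block_diag (1\<^sub>m n) (S m k)"
    using Cons.prems assms(2) by (intro S_shift) auto
  then show ?case
    using Cons block_diag_mult[OF one_carrier_mat one_carrier_mat S P, of n] by simp
qed

text \<open>The list \<open>ls\<close> is \<open>ks\<close> with \<open>m\<close> deleted. The
  remaining factors are the identity on the first block, so their product is a product for degree
  \<open>m\<close> behind an identity.\<close>

lemma fiedler_prod_split:
  assumes "distinct ks" "set ks = {..<Suc m}" and A: "\<And>j. j \<le> m \<Longrightarrow> A j \<in> carrier_mat n n"
  obtains ls where "distinct ls" "set ls = {..<m}"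
    "fiedler_prod (Suc m) ks = S (Suc m) m * block_diag (1\<^sub>m n) (fiedler_prod m ls) \<or>
     fiedler_prod (Suc m) ks = block_diag (1\<^sub>m n) (fiedler_prod m ls) * S (Suc m) m"
proof -
  have "m \<in> set ks"
    using assms(2) by auto
  then obtain xs ys where ks: "ks = xs @ m # ys"
    by (meson split_list)
  let ?N = "n * Suc m + r" and ?P = "fiedler_prod (Suc m)" and ?S = "S (Suc m) m"
  have d: "distinct (xs @ ys)" and s: "set (xs @ ys) = {..<m}"
    using assms(1,2) unfolding ks by (auto simp: lessThan_Suc)
  have A': "A j \<in> carrier_mat n n" if "j < Suc m" for j
    using A that by simp
  have sub: "set xs \<subseteq> {..<Suc m}" "set ys \<subseteq> {..<Suc m}"
    using assms(2) unfolding ks by auto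
  have x: "?P xs \<in> carrier_mat ?N ?N" and y: "?P ys \<in> carrier_mat ?N ?N"
    using sub by (simp_all only: fiedler_prod_carrier A')
  have S: "?S \<in> carrier_mat ?N ?N"
    using A by (intro S_carrier) auto
  \<comment> \<open>Only the neighbouring index \<open>m - 1\<close> can obstruct commutation. For
    \<open>m = 0\<close> the list \<open>zs\<close> is empty.\<close>
  have comm: "?S * ?P zs = ?P zs * ?S" if "set zs \<subseteq> {..<m}" "m - 1 \<notin> set zs" for zs
  proof (rule fiedler_prod_commute[OF S _ A'])
    show "set zs \<subseteq> {..<Suc m}"
      using that by auto
    show "?S * S (Suc m) k = S (Suc m) k * ?S" if "k \<in> set zs" for k
    proof (rule S_top_commute[OF _ A])
      have "k \<noteq> m - 1" "k < m"
        using \<open>set zs \<subseteq> {..<m}\<close> \<open>m - 1 \<notin> set zs\<close> that by auto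
      then show "Suc k < m"
        by simp
    qed
  qed
  have ks': "?P ks = ?P xs * (?S * ?P ys)"
    unfolding ks using assms(2)[unfolded ks] A' by (subst fiedler_prod_append) auto
  have "?P xs * ?P ys = ?P (xs @ ys)"
    using sub by (intro fiedler_prod_append[symmetric] A') auto
  also have "\<dots> = block_diag (1\<^sub>m n) (fiedler_prod m (xs @ ys))"
    using s by (intro fiedler_prod_shift A') auto
  finally have xy: "?P xs * ?P ys = block_diag (1\<^sub>m n) (fiedler_prod m (xs @ ys))" .
  \<comment> \<open>The index \<open>m - 1\<close> lies on only one side of \<open>m\<close>, so \<open>S (Suc m) m\<close> can be moved out on the other.\<close>
  consider "m - 1 \<notin> set xs" | "m - 1 \<notin> set ys"
    using d by auto
  then show thesis
  proof cases
    case 1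
    have "?P ks = ?P xs * ?S * ?P ys"
      unfolding ks' by (rule assoc_mult_mat[OF x S y, symmetric])
    also have "?P xs * ?S = ?S * ?P xs"
      using s 1 by (intro comm[symmetric]) auto
    also have "?S * ?P xs * ?P ys = ?S * (?P xs * ?P ys)"
      by (rule assoc_mult_mat[OF S x y])
    finally have "?P ks = ?S * (?P xs * ?P ys)" .
    then show thesis
      unfolding xy by (intro that[OF d s]) blast
  next
    case 2
    have "?S * ?P ys = ?P ys * ?S"
      using s 2 by (intro comm) auto
    then have "?P ks = ?P xs * ?P ys * ?S"
      unfolding ks' by (simp only: assoc_mult_mat[OF x y S])
    then show thesis
      unfolding xy by (intro that[OF d s]) blast
  qed
qed

section \<open>Reduction of the pencil by Horner's scheme\<close>

text \<open>The part of the leading term of degree \<open>Suc k\<close> behind its first block; an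
  elimination step only shortens it.\<close>

definition tail :: "nat \<Rightarrow> complex poly mat" where
  "tail k = block_diag (monom 1 1 \<cdot>\<^sub>m 1\<^sub>m (n * k)) (monom 1 1 \<cdot>\<^sub>m const_pm (- E))"

text \<open>A Fiedler pencil of degree \<open>Suc k\<close> whose leading coefficient
  \<open>P\<close> may depend on the variable, as it does after the first Horner step.\<close>

definition pencil :: "nat \<Rightarrow> complex poly mat \<Rightarrow> nat list \<Rightarrow> complex poly mat" where
  "pencil k P ks = block_diag (monom 1 1 \<cdot>\<^sub>m P) (tail k) - const_pm (fiedler_prod (Suc k) ks)"

text \<open>The system polynomial of formal degree \<open>Suc k\<close> with \<open>P\<close> in
  place of the coefficient \<open>A (Suc k)\<close>.\<close>

definition target :: "nat \<Rightarrow> complex poly mat \<Rightarrow> complex poly mat" where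
  "target k P = four_block_mat
     (mat n n (\<lambda>(i, j). monom 1 (Suc k) * P $$ (i, j) + (\<Sum>l\<le>k. monom (A l $$ (i, j)) l)))
     (const_pm C) (const_pm B) (const_pm Ap - lam_pm E)"

lemma tail_carrier: "tail k \<in> carrier_mat (n * k + r) (n * k + r)"
  unfolding tail_def const_pm_uminus using E by (intro block_diag_carrier) auto

lemma tail_Suc: "tail (Suc k) = block_diag (monom 1 1 \<cdot>\<^sub>m 1\<^sub>m n) (tail k)"
  by (simp add: tail_def block_diag_assoc flip: block_diag_one smult_block_diag)

lemma pencil_carrier:
  assumes "P \<in> carrier_mat n n" "set ks \<subseteq> {..k}" and A: "\<And>j. j \<le> k \<Longrightarrow> A j \<in> carrier_mat n n"
  shows "pencil k P ks \<in> carrier_mat (n * Suc k + r) (n * Suc k + r)"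
proof -
  have "fiedler_prod (Suc k) ks \<in> carrier_mat (n * Suc k + r) (n * Suc k + r)"
    using assms(2) by (intro fiedler_prod_carrier A) auto
  then show ?thesis
    unfolding pencil_def by (intro minus_carrier_mat) simp
qed

lemma target_carrier: "target k P \<in> carrier_mat (n + r) (n + r)"
  using E by (simp add: target_def lam_pm_conv_const_pm minus_carrier_mat)

text \<open>Horner's rule: with \<open>x\<close> the variable,
  \<open>x^(k+2) P + x^(k+1) A (Suc k) = x^(k+1) (x P + A (Suc k))\<close>.\<close>

lemma target_Suc:
  assumes "P \<in> carrier_mat n n" "A (Suc k) \<in> carrier_mat n n"
  shows "target (Suc k) P = target k (monom 1 1 \<cdot>\<^sub>m P + const_pm (A (Suc k)))"
proof -
  have "monom 1 (Suc (Suc k)) * P $$ (i, j) + (\<Sum>l\<le>Suc k. monom (A l $$ (i, j)) l) =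
      monom 1 (Suc k) * (monom 1 1 \<cdot>\<^sub>m P + const_pm (A (Suc k))) $$ (i, j) + (\<Sum>l\<le>k. monom (A l $$ (i, j)) l)"
    if "i < n" "j < n" for i j
  proof -
    have "monom 1 (Suc k) * [:a:] = monom a (Suc k)" for a :: complex
      by (simp add: smult_monom mult.commute)
    moreover have "monom 1 (Suc (Suc k)) = monom 1 (Suc k) * (monom 1 1 :: complex poly)"
      by (simp add: mult_monom)
    ultimately show ?thesis
      using assms that by (simp add: const_pm_def algebra_simps)
  qed
  then show ?thesis
    unfolding target_def by (intro cong_four_block_mat refl cong_mat) auto
qed

text \<open>Only the factor of index 0 is left. In degree 1 its borders are \<open>-C\<close> and
  \<open>-B\<close> themselves, and subtracting it turns all four signs.\<close>

lemma pencil_0: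
  assumes "P \<in> carrier_mat n n" "A 0 \<in> carrier_mat n n"
  shows "pencil 0 P [0] = target 0 P"
proof -
  have e: "em_kron_col n (Suc 0) C = C" "em_kron_row n (Suc 0) B = B"
    using C B by (auto simp: em_kron_col_def em_kron_row_def intro!: eq_matI)
  have S: "S 1 0 = four_block_mat (- A 0) (- C) (- B) (- Ap)"
    using S_0[of 0] assms by (simp add: e)
  moreover have "S 1 0 \<in> carrier_mat (n + r) (n + r)"
    using S_carrier[of 0 1] assms by simp
  then have "S 1 0 * 1\<^sub>m (n + r) = S 1 0"
    by (rule right_mult_one_mat)
  ultimately have "fiedler_prod 1 [0] = four_block_mat (- A 0) (- C) (- B) (- Ap)"
    by simp
  then have "const_pm (fiedler_prod 1 [0]) =
      four_block_mat (const_pm (- A 0)) (const_pm (- C)) (const_pm (- B)) (const_pm (- Ap))"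
    using assms C B Ap by (simp add: const_pm_four_block_mat[of _ n n _ r _ r])
  moreover have "block_diag (monom 1 1 \<cdot>\<^sub>m P) (tail 0) =
      four_block_mat (monom 1 1 \<cdot>\<^sub>m P) (0\<^sub>m n r) (0\<^sub>m r n) (- lam_pm E)"
    using assms E by (auto simp: block_diag_def tail_def lam_pm_conv_const_pm const_pm_def intro!: eq_matI)
  ultimately show ?thesis
    using assms C B Ap E unfolding pencil_def target_def
    by (intro eq_matI) (auto simp: const_pm_def lam_pm_def monom_0)
qed

text \<open>Induction on \<open>k\<close> with \<open>P\<close> and \<open>ks\<close> arbitrary,
  since each elimination replaces \<open>P\<close> by \<open>G\<close> and deletes the top index
  from the list.\<close>

lemma pencil_sys_equiv:
  assumes "P \<in> carrier_mat n n" "distinct ks" "set ks = {..k}"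
    and "\<And>j. j \<le> k \<Longrightarrow> A j \<in> carrier_mat n n"
  shows "sys_equiv (n * Suc k) r (pencil k P ks) (block_diag (1\<^sub>m (n * k)) (target k P))"
  using assms
proof (induction k arbitrary: P ks)
  case 0
  then have "ks = [0]"
    by (cases ks) (auto simp: subset_singleton_iff)
  then show ?case
    using 0 pencil_0 target_carrier[of 0 P] by (simp add: sys_equiv_refl)
next
  case (Suc k)
  let ?x = "monom 1 1 :: complex poly"
  define G where "G = ?x \<cdot>\<^sub>m P + const_pm (A (Suc k))"
  have A: "A j \<in> carrier_mat n n" if "j \<le> Suc k" for j
    using Suc.prems that by simp
  have G: "G \<in> carrier_mat n n"
    using Suc.prems by (simp add: G_def)
  obtain ls where ls: "distinct ls" "set ls = {..k}"
    and split: "fiedler_prod (Suc (Suc k)) ks =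
        S (Suc (Suc k)) (Suc k) * block_diag (1\<^sub>m n) (fiedler_prod (Suc k) ls) \<or>
      fiedler_prod (Suc (Suc k)) ks =
        block_diag (1\<^sub>m n) (fiedler_prod (Suc k) ls) * S (Suc (Suc k)) (Suc k)"
    using fiedler_prod_split[of ks "Suc k"] Suc.prems by (metis lessThan_Suc_atMost)
  \<comment> \<open>The sizes are regrouped to expose the first two blocks, on which the elimination
    acts.\<close>
  have N: "n * Suc (Suc k) + r = n + (n + (n * k + r))" "n * Suc k + r = n + (n * k + r)"
    by simp_all
  let ?M = "block_diag (four_block_mat (- const_pm (A (Suc k))) (1\<^sub>m n) (1\<^sub>m n) (0\<^sub>m n n)) (1\<^sub>m (n * k + r))"
  have Q: "fiedler_prod (Suc k) ls \<in> carrier_mat (n + (n * k + r)) (n + (n * k + r))"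
    using ls A unfolding N(2)[symmetric] by (intro fiedler_prod_carrier) auto
  have S: "S (Suc (Suc k)) (Suc k) \<in> carrier_mat (n + (n + (n * k + r))) (n + (n + (n * k + r)))"
    using A unfolding N(1)[symmetric] by (intro S_carrier) auto
  have "const_pm (S (Suc (Suc k)) (Suc k)) = ?M"
    using A[of "Suc k"] S_top[of "Suc k"]
    by (simp add: const_pm_block_diag const_pm_four_block_mat[of _ n n _ n _ n] const_pm_uminus)
  moreover have "block_diag (1\<^sub>m n) (fiedler_prod (Suc k) ls)
      \<in> carrier_mat (n + (n + (n * k + r))) (n + (n + (n * k + r)))"
    using Q by (intro block_diag_carrier) auto
  ultimately have T: "const_pm (fiedler_prod (Suc (Suc k)) ks)
        = ?M * block_diag (1\<^sub>m n) (const_pm (fiedler_prod (Suc k) ls)) \<or>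
      const_pm (fiedler_prod (Suc (Suc k)) ks)
        = block_diag (1\<^sub>m n) (const_pm (fiedler_prod (Suc k) ls)) * ?M"
    using split const_pm_mult[OF S] const_pm_mult[OF _ S] by (auto simp: const_pm_block_diag)
  \<comment> \<open>One elimination, with \<open>s = n * k\<close>, \<open>D = tail k\<close> and
    the shorter product as \<open>Q\<close>.\<close>
  have "sys_equiv (n + (n + n * k)) r (pencil (Suc k) P ks) (block_diag (1\<^sub>m n) (pencil k G ls))"
    unfolding pencil_def tail_Suc G_def
    using Suc.prems A Q tail_carrier by (intro sys_equiv_elimination[OF _ _ _ _ refl T]) auto
  \<comment> \<open>The induction hypothesis for \<open>G\<close> and \<open>ls\<close>, applied
    below the identity block just split off.\<close>
  moreover have "sys_equiv (n + n * Suc k) r (block_diag (1\<^sub>m n) (pencil k G ls))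
      (block_diag (1\<^sub>m n) (block_diag (1\<^sub>m (n * k)) (target k G)))"
    using G ls A by (intro sys_equiv_block_diag_one pencil_carrier Suc.IH) auto
  moreover have "pencil (Suc k) P ks \<in> carrier_mat (n * Suc (Suc k) + r) (n * Suc (Suc k) + r)"
    using Suc.prems by (intro pencil_carrier) auto
  moreover have "target (Suc k) P = target k G"
    unfolding G_def using Suc.prems by (intro target_Suc) auto
  ultimately show ?case
    using sys_equiv_trans[of "pencil (Suc k) P ks" "n * Suc (Suc k)" r] by (simp add: block_diag_assoc)
qed

end

section \<open>Fiedler pencils of a system polynomial as instances of the reduction\<close>

theorem theorem4p13:
  fixes n m r :: nat and A :: "nat \<Rightarrow> complex mat" and C B Ap E :: "complex mat"
    and \<sigma> :: "nat \<Rightarrow> nat"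
  assumes "2 \<le> m"
    and "\<And>j. j \<le> m \<Longrightarrow> A j \<in> carrier_mat n n"
    and "A m \<noteq> 0\<^sub>m n n"
    and "C \<in> carrier_mat n r" and "B \<in> carrier_mat r n"
    and "Ap \<in> carrier_mat r r" and "E \<in> carrier_mat r r"
    and "bij_betw \<sigma> {0..<m} {1..m}"
  shows "rosenbrock_linearization n m r (fiedler_pencil n m r A C B Ap E \<sigma>)
           (system_poly n m A C B Ap E)"
proof -
  interpret system_data n r A C B Ap E
    using assms by unfold_locales auto
  obtain k where m: "m = Suc k"
    using assms(1) by (cases m) auto
  let ?\<tau> = "the_inv_into {0..<m} \<sigma>"
  \<comment> \<open>The factor indices from left to right, \<open>\<sigma>\<close> inverse at
    \<open>1, ..., m\<close>: a permutation of \<open>0, ..., m - 1\<close>.\<close>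
  define ks where "ks = map ?\<tau> [1..<m + 1]"
  have Am: "A m \<in> carrier_mat n n"
    using assms by simp
  have "bij_betw ?\<tau> {1..m} {0..<m}"
    using assms(8) by (rule bij_betw_the_inv_into)
  moreover have "set [1..<m + 1] = {1..m}" "{0..<m} = {..k}"
    using m by auto
  ultimately have ks: "distinct ks" "set ks = {..k}"
    unfolding ks_def by (simp_all only: distinct_map set_map bij_betw_def distinct_upt simp_thms)
  have prod: "foldr (\<lambda>k acc. S m (?\<tau> k) * acc) [1..<m + 1] (1\<^sub>m (n * m + r)) = fiedler_prod m ks"
    by (simp only: ks_def fiedler_prod_def foldr_map o_def)
  \<comment> \<open>Splitting off the first block of the leading factor shows that the reduction
    starts with \<open>P = A m\<close>.\<close>
  have "S m m = block_diag (A m) (block_diag (1\<^sub>m (n * k)) (- E))"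
    using m by (simp add: sys_fiedler_M_def fiedler_M_def block_diag_assoc mult.commute)
  then have "lam_pm (S m m) = block_diag (monom 1 1 \<cdot>\<^sub>m const_pm (A m)) (tail k)"
    by (simp add: tail_def lam_pm_conv_const_pm const_pm_block_diag smult_block_diag)
  then have L: "fiedler_pencil n m r A C B Ap E \<sigma> = pencil k (const_pm (A m)) ks"
    by (simp only: fiedler_pencil_def prod pencil_def m[symmetric])
  \<comment> \<open>The term of \<open>P = A m\<close> supplies the summand of index
    \<open>m = Suc k\<close>.\<close>
  have "monom 1 m * const_pm (A m) $$ (i, j) + (\<Sum>l\<le>k. monom (A l $$ (i, j)) l)
      = (\<Sum>l\<le>m. monom (A l $$ (i, j)) l)" if "i < n" "j < n" for i j
    using that Am m by (simp add: const_pm_def smult_monom mult.commute)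
  then have X: "system_poly n m A C B Ap E = target k (const_pm (A m))"
    unfolding system_poly_def target_def mat_poly_def m
    by (intro cong_four_block_mat refl cong_mat) auto
  have "sys_equiv (n * m) r (pencil k (const_pm (A m)) ks) (block_diag (1\<^sub>m (n * k)) (target k (const_pm (A m))))"
    using pencil_sys_equiv[of "const_pm (A m)" ks k] ks Am assms(2) m by simp
  then obtain U V where "U \<in> carrier_mat (n * m) (n * m)" "V \<in> carrier_mat (n * m) (n * m)"
    "det U = 1" "det V = 1"
    "block_diag U (1\<^sub>m r) * pencil k (const_pm (A m)) ks * block_diag V (1\<^sub>m r)
      = block_diag (1\<^sub>m ((m - 1) * n)) (target k (const_pm (A m)))"
    unfolding sys_equiv_def m by (auto simp: mult.commute)
  then show ?thesis
    unfolding rosenbrock_linearization_def L X unimodular_def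
    \<comment> \<open>The nonzero constant in \<open>unimodular\<close> is 1 for both
      matrices.\<close>
    by (intro exI[of _ U] exI[of _ V]) (auto simp: one_pCons intro!: exI[of _ 1])
qed

end
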